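(* Let $P$ be a Schröder path and let $(x,z)\in\mathbb{Z}^2$ be a point on $P$ with $z>x+1$ such that the bounce path of $P$ at $(x,z)$ has exactly one bounce point and the bounce decomposition of $P$ at $(x,z)$ is $P=U\mathtt{n}\cdot\mathtt{n}V\mathtt{d}\cdot\mathtt{e}W$. Let $Q=U\mathtt{n}\mathtt{n}V\mathtt{e}\mathtt{d}W$. Then $\mathrm{LLTe}_P(\mathbf{x};q+1)=(q+1)\,\mathrm{LLTe}_Q(\mathbf{x};q+1)$.
   Context: Steps: $\mathtt{n}=(0,1)$, $\mathtt{e}=(1,0)$, $\mathtt{d}=(1,1)$. A Schröder path of size $n$ is a lattice path from $(0,0)$ to $(n,n)$ with steps in $\{\mathtt{n},\mathtt{e},\mathtt{d}\}$ such that every east and every diagonal step is preceded by strictly more north steps than east steps; paths are words in $\{\mathtt{n},\mathtt{d},\mathtt{e}\}^*$. Bounce path of $P$ (size $n$) at a lattice point $(u_1,u_0)$ on $P$: move south from $(u_1,u_0)$ to $(u_1,u_1)$, then west until first reaching a point $(u_2,u_1)$ of $P$; if that point lies between two diagonal steps of $P$, continue south to $(u_2,u_2)$ and west to a point $(u_3,u_2)$ of $P$, and so on, stopping at the first point $(u_{k+1},u_k)$ incident to a north or east step of $P$. The points $(u_i,u_i)$ are the bounce points. The bounce decomposition at $(u_1,u_0)$ is the unique factorisation $P=Us_1\cdot s_2Vs_3\cdot s_4W$ ($s_i$ single steps) where $Us_1$ is the part of $P$ from $(0,0)$ to $(u_{k+1},u_k)$ and $s_4W$ is the part from $(u_1,u_0)$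 to $(n,n)$; dots are only markers. $\Gamma_P$ is the graph on $[n]$ where, for $1\le a<b\le n$, $\{a,b\}$ is a non-strict edge if the unit square $[a-1,a]\times[b-1,b]$ lies in the region between $P$ and the line $y=x$, and a strict edge if $P$ has a diagonal step from $(a-1,b-1)$ to $(a,b)$. An orientation is a set $\theta$ containing, for each edge $\{u,v\}$, exactly one of $u\to v$, $v\to u$; $\mathcal{O}(P)$ is the set of orientations orienting each strict edge $\{u,v\}$, $u<v$, as $u\to v$. An edge $u\to v\in\theta$ is ascending if $u<v$ and $\{u,v\}$ is non-strict; $\mathrm{asc}(\theta)$ counts them. $\mathrm{hrv}_\theta(u)$ is the maximal $v$ reachable from $u$ by a directed path (possibly empty) in $\theta$ using only strict and ascending edges; $\lambda(\theta)$ is the partition formed by the sizes of the classes of vertices with equal $\mathrm{hrv}_\theta$. $\mathrm{LLTe}_P(\mathbf{x};q+1)=\sum_{\theta\in\mathcal{O}(P)}q^{\mathrm{asc}(\theta)}\mathrm{e}_{\lambda(\theta)}(\mathbf{x})$, with $\mathrm{e}_\lambda$ the elementary symmetric functions. *)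

theory Defs
  imports "HOL-Analysis.Analysis" "HOL-Library.Multiset"
    "HOL-Computational_Algebra.Polynomial"
begin

section \<open>Schroeder paths\<close>

datatype step = North | East | Diag

fun step_vec :: "step \<Rightarrow> int \<times> int" where
  "step_vec North = (0, 1)"
| "step_vec East = (1, 0)"
| "step_vec Diag = (1, 1)"

text \<open>Endpoint of the lattice path that starts at the origin and has step word \<open>P\<close>.\<close>
definition endpoint :: "step list \<Rightarrow> int \<times> int" where
  "endpoint P = (\<Sum>s\<leftarrow>P. step_vec s)"

definition vertex_at :: "step list \<Rightarrow> nat \<Rightarrow> int \<times> int" where
  "vertex_at P i = endpoint (take i P)"

definition schroeder_path :: "nat \<Rightarrow> step list \<Rightarrow> bool" where
  "schroeder_path n P \<longleftrightarrow>
     endpoint P = (int n, int n) \<and>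
     (\<forall>i < length P. P ! i \<in> {East, Diag} \<longrightarrow>
        count_list (take i P) North > count_list (take i P) East)"

definition lattice_points :: "step list \<Rightarrow> (int \<times> int) set" where
  "lattice_points P = vertex_at P ` {..length P}"


section \<open>Bounce paths\<close>

definition between_diagonals :: "step list \<Rightarrow> int \<times> int \<Rightarrow> bool" where
  "between_diagonals P p \<longleftrightarrow>
     (\<exists>i. Suc i < length P \<and> vertex_at P (Suc i) = p \<and> P ! i = Diag \<and> P ! Suc i = Diag)"

definition incident_north_east :: "step list \<Rightarrow> int \<times> int \<Rightarrow> bool" where
  "incident_north_east P p \<longleftrightarrow>
     (\<exists>i < length P. P ! i \<in> {North, East} \<and> (vertex_at P i = p \<or> vertex_at P (Suc i) = p))"

text \<open>
  Walking west from \<open>(u, u)\<close>, the first point of \<open>P\<close> that is met is \<open>(v, u)\<close>; the starting point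
  \<open>(u, u)\<close> itself counts if it is on \<open>P\<close>. At an integer height \<open>P\<close> can only be met for the first
  time in a lattice point.
\<close>
definition first_point_west :: "step list \<Rightarrow> int \<Rightarrow> int \<Rightarrow> bool" where
  "first_point_west P u v \<longleftrightarrow>
     v \<le> u \<and> (v, u) \<in> lattice_points P \<and> (\<forall>w. v < w \<and> w \<le> u \<longrightarrow> (w, u) \<notin> lattice_points P)"

text \<open>
  \<open>bounce_path P p bs r\<close>: the bounce path of \<open>P\<close> at \<open>p\<close> has the list of bounce points \<open>bs\<close> and
  stops at the point \<open>r\<close> of \<open>P\<close>. If \<open>p = (u\<^sub>1, u\<^sub>0)\<close>, then
  \<open>bs = [(u\<^sub>1, u\<^sub>1), \<dots>, (u\<^sub>k, u\<^sub>k)]\<close> and \<open>r = (u\<^sub>k\<^sub>+\<^sub>1, u\<^sub>k)\<close>.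
\<close>
inductive bounce_path ::
  "step list \<Rightarrow> int \<times> int \<Rightarrow> (int \<times> int) list \<Rightarrow> int \<times> int \<Rightarrow> bool" for P where
  stop: "first_point_west P u v \<Longrightarrow> incident_north_east P (v, u)
           \<Longrightarrow> bounce_path P (u, t) [(u, u)] (v, u)"
| bounce: "first_point_west P u v \<Longrightarrow> between_diagonals P (v, u)
           \<Longrightarrow> bounce_path P (v, u) bs r \<Longrightarrow> bounce_path P (u, t) ((u, u) # bs) r"

definition bounce_decomposition ::
  "step list \<Rightarrow> int \<times> int \<Rightarrow> step list \<Rightarrow> step \<Rightarrow> step \<Rightarrow> step list \<Rightarrow> step \<Rightarrow> step \<Rightarrow> step list \<Rightarrow> bool"
where
  "bounce_decomposition P p U s1 s2 V s3 s4 W \<longleftrightarrow>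
     P = U @ [s1] @ [s2] @ V @ [s3] @ [s4] @ W \<and>
     (\<exists>bs. bounce_path P p bs (endpoint (U @ [s1]))) \<and>
     endpoint (U @ [s1] @ [s2] @ V @ [s3]) = p"


section \<open>The decorated graph of a path\<close>

definition real_point :: "int \<times> int \<Rightarrow> real \<times> real" where
  "real_point p = (real_of_int (fst p), real_of_int (snd p))"

definition path_curve :: "step list \<Rightarrow> (real \<times> real) set" where
  "path_curve P =
     (\<Union>i<length P. closed_segment (real_point (vertex_at P i)) (real_point (vertex_at P (Suc i))))"

text \<open>The closed region between \<open>P\<close> and the line \<open>y = x\<close>.\<close>
definition region :: "step list \<Rightarrow> (real \<times> real) set" where
  "region P = {(s, t). s \<le> t \<and> (\<exists>t'. t \<le> t' \<and> (s, t') \<in> path_curve P)}"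

text \<open>For a Schroeder path of size \<open>n\<close> this is \<open>[n]\<close>.\<close>
definition vertices :: "step list \<Rightarrow> int set" where
  "vertices P = {1..fst (endpoint P)}"

definition nonstrict_edges :: "step list \<Rightarrow> int set set" where
  "nonstrict_edges P =
     {{a, b} | a b. a \<in> vertices P \<and> b \<in> vertices P \<and> a < b \<and>
        {real_of_int (a - 1)..real_of_int a} \<times> {real_of_int (b - 1)..real_of_int b} \<subseteq> region P}"

definition strict_edges :: "step list \<Rightarrow> int set set" where
  "strict_edges P =
     {{a, b} | a b. a \<in> vertices P \<and> b \<in> vertices P \<and> a < b \<and>
        (\<exists>i < length P. P ! i = Diag \<and>
           vertex_at P i = (a - 1, b - 1) \<and> vertex_at P (Suc i) = (a, b))}"

definition edges :: "step list \<Rightarrow> int set set" where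
  "edges P = nonstrict_edges P \<union> strict_edges P"


section \<open>Orientations\<close>

text \<open>A pair \<open>(u, v)\<close> stands for the directed edge from \<open>u\<close> to \<open>v\<close>.\<close>
definition orientations :: "step list \<Rightarrow> (int \<times> int) set set" where
  "orientations P =
     {\<theta>. (\<forall>(u, v) \<in> \<theta>. {u, v} \<in> edges P) \<and>
         (\<forall>u v. {u, v} \<in> edges P \<longrightarrow> ((u, v) \<in> \<theta>) \<noteq> ((v, u) \<in> \<theta>))}"

definition path_orientations :: "step list \<Rightarrow> (int \<times> int) set set" where
  "path_orientations P =
     {\<theta> \<in> orientations P. \<forall>u v. u < v \<and> {u, v} \<in> strict_edges P \<longrightarrow> (u, v) \<in> \<theta>}"

definition ascending_edges :: "step list \<Rightarrow> (int \<times> int) set \<Rightarrow> (int \<times> int) set" where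
  "ascending_edges P \<theta> = {(u, v) \<in> \<theta>. u < v \<and> {u, v} \<in> nonstrict_edges P}"

definition asc :: "step list \<Rightarrow> (int \<times> int) set \<Rightarrow> nat" where
  "asc P \<theta> = card (ascending_edges P \<theta>)"

definition hrv :: "step list \<Rightarrow> (int \<times> int) set \<Rightarrow> int \<Rightarrow> int" where
  "hrv P \<theta> u = Max {v. (u, v) \<in> ({(a, b) \<in> \<theta>. {a, b} \<in> strict_edges P} \<union> ascending_edges P \<theta>)\<^sup>*}"

text \<open>The partition \<open>\<lambda>(\<theta>)\<close>, as a weakly decreasing list.\<close>
definition orientation_partition :: "step list \<Rightarrow> (int \<times> int) set \<Rightarrow> nat list" where
  "orientation_partition P \<theta> =
     rev (sorted_list_of_multiset
       {#card {u \<in> vertices P. hrv P \<theta> u = v}. v \<in># mset_set (hrv P \<theta> ` vertices P)#})"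


section \<open>Elementary symmetric functions\<close>

text \<open>
  Symmetric functions are formal power series in countably many variables \<open>x\<^sub>0, x\<^sub>1, \<dots>\<close>. A series
  is the function that maps each monomial to its coefficient, and a monomial is the multiset of
  the indices of its variables, so that \<open>x\<^sub>0\<^sup>2 x\<^sub>3\<close> is \<open>{#0, 0, 3#}\<close>.
\<close>
type_synonym 'a series = "nat multiset \<Rightarrow> 'a"

definition series_one :: "'a::comm_semiring_1 series" where
  "series_one M = (if M = {#} then 1 else 0)"

text \<open>The Cauchy product; a multiset has only finitely many submultisets.\<close>
definition series_mult :: "'a::comm_semiring_1 series \<Rightarrow> 'a series \<Rightarrow> 'a series" where
  "series_mult f g M = (\<Sum>A | A \<subseteq># M. f A * g (M - A))"

definition elem_sym :: "nat \<Rightarrow> 'a::comm_semiring_1 series" where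
  "elem_sym k M = (if size M = k \<and> (\<forall>i. count M i \<le> 1) then 1 else 0)"

definition elem_sym_partition :: "nat list \<Rightarrow> 'a::comm_semiring_1 series" where
  "elem_sym_partition ls = foldr (\<lambda>k f. series_mult (elem_sym k) f) ls series_one"


section \<open>The polynomial attached to a path\<close>

text \<open>The indeterminate \<open>q\<close> of the coefficient ring \<open>\<int>[q]\<close>.\<close>
abbreviation qvar :: "int poly" where
  "qvar \<equiv> [:0, 1:]"

text \<open>
  \<open>LLTe P t\<close> is \<open>LLTe\<^sub>P(\<^bold>x; t)\<close>. It is defined by the expansion of \<open>LLTe\<^sub>P(\<^bold>x; q + 1)\<close> in powers
  of \<open>q\<close>, whence the exponentiated \<open>t - 1\<close>.
\<close>
definition LLTe :: "step list \<Rightarrow> int poly \<Rightarrow> int poly series" where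
  "LLTe P t M =
     (\<Sum>\<theta> \<in> path_orientations P.
        (t - 1) ^ asc P \<theta> * elem_sym_partition (orientation_partition P \<theta>) M)"

end

theory Submission
  imports Defs
begin

text \<open>
  An orientation is the same as the set \<open>X\<close> of its ascending edges, so \<open>LLTe\<close> is a sum over all
  subsets of the non-strict edges, and \<open>\<lambda>(\<theta>)\<close> only depends on the highest vertices that are
  reachable in the digraph of strict and ascending edges. Put \<open>a = x\<close>, \<open>b = x + 1\<close>, \<open>c = z\<close>. The
  graphs of \<open>P\<close> and \<open>Q\<close> differ only in the edges among \<open>a\<close>, \<open>b\<close>, \<open>c\<close>: \<open>ab\<close> is non-strict in both; \<open>P\<close> has
  \<open>ac\<close> strict and \<open>bc\<close> non-strict, while \<open>Q\<close> has \<open>bc\<close> strict and no edge \<open>ac\<close>. Since \<open>P\<close> passes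
  the height \<open>x\<close> between two north steps, the rest of the graph is invariant under the transposition
  of \<open>a\<close> and \<open>b\<close>.

  Fix an orientation \<open>H\<close> of the rest and write \<open>[E]\<close> for the term of \<open>H\<close> together with the directed
  edges \<open>E\<close>. Then \<open>P\<close> contributes \<open>q\<^sup>2 [ab, bc, ac] + q [ab, ac] + q [ac, bc] + [ac]\<close> and \<open>Q\<close>
  contributes \<open>q [ab, bc] + [bc]\<close>. Here \<open>[ab, bc, ac] = [ab, bc]\<close>, and \<open>[ac]\<close> agrees with \<open>[bc]\<close>
  after summation over \<open>H\<close>, by transposition. It remains to see that \<open>[ab, ac] + [ac, bc]\<close> and
  \<open>[ab, bc] + [bc]\<close> have the same sum. Adding the transposed terms makes this an identity for each
  single \<open>H\<close>: every term is determined by the highest vertices reachable from \<open>a\<close> and from \<open>b\<close>, and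
  these are maxima of the corresponding values \<open>A\<close>, \<open>B\<close>, \<open>C\<close> of \<open>a\<close>, \<open>b\<close>, \<open>c\<close> in \<open>H\<close>, so that the terms
  cancel in pairs whichever of \<open>A\<close>, \<open>B\<close>, \<open>C\<close> is the largest.
\<close>

section \<open>Highest reachable vertices\<close>

text \<open>This is \<open>hrv\<close> for a plain digraph. \<open>Max\<close> is meaningful when
  the digraph is finite.\<close>

definition highest_reach :: "('a::linorder \<times> 'a) set \<Rightarrow> 'a \<Rightarrow> 'a" where
  "highest_reach D u = Max (D\<^sup>* `` {u})"

lemma finite_reach: "finite D \<Longrightarrow> finite (D\<^sup>* `` {u})"
proof -
  assume "finite D"
  have "D\<^sup>* `` {u} \<subseteq> insert u (Range D)"
    by (auto elim: rtranclE)
  with \<open>finite D\<close> show ?thesis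
    by (metis finite_Range finite_insert finite_subset)
qed

text \<open>A directed walk is empty or begins with an edge out of \<open>u\<close>.\<close>

lemma highest_reach_rec:
  assumes "finite D"
  shows "highest_reach D u = Max (insert u (highest_reach D ` (D `` {u})))"
proof (rule antisym)
  have fin: "finite (insert u (highest_reach D ` (D `` {u})))"
    using assms by (simp add: finite_Image)
  have ne: "D\<^sup>* `` {w} \<noteq> {}" for w by auto
  show "highest_reach D u \<le> Max (insert u (highest_reach D ` (D `` {u})))"
    unfolding highest_reach_def[of D u]
  proof (intro Max.boundedI ne finite_reach assms)
    fix v assume "v \<in> D\<^sup>* `` {u}"
    then have "(u, v) \<in> D\<^sup>*" by simp
    then show "v \<le> Max (insert u (highest_reach D ` (D `` {u})))"
    proof (cases rule: converse_rtranclE)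
      case base
      then show ?thesis using fin by auto
    next
      case (step w)
      then have "v \<le> highest_reach D w"
        unfolding highest_reach_def by (intro Max_ge finite_reach assms) auto
      moreover have "highest_reach D w \<le> Max (insert u (highest_reach D ` (D `` {u})))"
        using step fin by (intro Max_ge) auto
      ultimately show ?thesis by order
    qed
  qed
  show "Max (insert u (highest_reach D ` (D `` {u}))) \<le> highest_reach D u"
  proof (intro Max.boundedI fin)
    fix v assume "v \<in> insert u (highest_reach D ` (D `` {u}))"
    then consider "v = u" | w where "(u, w) \<in> D" "v = highest_reach D w" by auto
    then show "v \<le> highest_reach D u"
    proof cases
      case 1
      then show ?thesis
        unfolding highest_reach_def by (intro Max_ge finite_reach assms) auto
    next
      case 2
      have "D\<^sup>* `` {w} \<subseteq> D\<^sup>* `` {u}"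
        using 2(1) by (auto intro: converse_rtrancl_into_rtrancl)
      then show ?thesis
        unfolding highest_reach_def 2(2) by (intro Max_mono ne finite_reach assms)
    qed
  qed simp
qed

text \<open>\<open>K\<close> collects the vertices whose values are known to agree. Elsewhere in
  \<open>Z\<close> the recursion transfers agreement from the successors, which are larger and stay
  in \<open>Z\<close>.\<close>

lemma highest_reach_cong:
  assumes fin: "finite D" "finite D'"
    and K: "\<And>u. u \<in> Z \<Longrightarrow> u \<in> K \<Longrightarrow> highest_reach D u = highest_reach D' u"
    and succ: "\<And>u. u \<in> Z \<Longrightarrow> u \<notin> K \<Longrightarrow> D `` {u} = D' `` {u} \<and> D `` {u} \<subseteq> Z \<inter> {u<..}"
    and "u \<in> Z"
  shows "highest_reach D u = highest_reach D' u"
  using \<open>u \<in> Z\<close>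
\<comment> \<open>Counting only the edge targets above \<open>u\<close> keeps the measure
  finite.\<close>
proof (induction "card {v \<in> Range D. u < v}" arbitrary: u rule: less_induct)
  case less
  show ?case
  proof (cases "u \<in> K")
    case False
    note s = succ[OF less.prems False]
    have "highest_reach D w = highest_reach D' w" if w: "w \<in> D `` {u}" for w
    proof (rule less.hyps)
      have "u < w" "w \<in> Range D" using w s by auto
      then have "{v \<in> Range D. w < v} \<subset> {v \<in> Range D. u < v}" by auto
      then show "card {v \<in> Range D. w < v} < card {v \<in> Range D. u < v}"
        using fin(1) by (intro psubset_card_mono) (simp_all add: finite_Range)
      show "w \<in> Z" using w s by auto
    qed
    then have "highest_reach D ` (D `` {u}) = highest_reach D' ` (D' `` {u})"
      using s by (metis image_cong)
    then show ?thesis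
      by (simp add: highest_reach_rec[OF fin(1), of u] highest_reach_rec[OF fin(2), of u])
  qed (use K less.prems in blast)
qed

text \<open>Beyond a first edge in \<open>H\<close>, the edges of \<open>E\<close> change no value,
  so such walks contribute the value in \<open>H\<close>; only first edges in \<open>E\<close>
  remain.\<close>

lemma highest_reach_union:
  assumes "finite H" "finite E"
    and "\<And>w. (u, w) \<in> H \<Longrightarrow> highest_reach (H \<union> E) w = highest_reach H w"
  shows "highest_reach (H \<union> E) u = Max (insert (highest_reach H u) (highest_reach (H \<union> E) ` (E `` {u})))"
proof -
  have fin: "finite (highest_reach H ` (H `` {u}))" "finite (highest_reach (H \<union> E) ` (E `` {u}))"
    using assms(1,2) by (simp_all add: finite_Image)
  have "highest_reach (H \<union> E) ` ((H \<union> E) `` {u})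
      = highest_reach H ` (H `` {u}) \<union> highest_reach (H \<union> E) ` (E `` {u})"
    using assms(3) by force
  then have "highest_reach (H \<union> E) u =
      Max (insert u (highest_reach H ` (H `` {u})) \<union> highest_reach (H \<union> E) ` (E `` {u}))"
    using assms by (simp add: highest_reach_rec[of "H \<union> E" u])
  also have "\<dots> = Max (insert (highest_reach H u) (highest_reach (H \<union> E) ` (E `` {u})))"
  proof (cases "E `` {u} = {}")
    case True
    then show ?thesis by (simp add: highest_reach_rec[OF assms(1), of u])
  next
    case False
    then show ?thesis
      using fin by (subst Max.union)
        (auto simp del: Max_insert simp: highest_reach_rec[OF assms(1), of u] Max.insert[of "highest_reach (H \<union> E) ` (E `` {u})"])
  qed
  finally show ?thesis .
qed

section \<open>Transposing two adjacent vertices of a digraph\<close>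

lemma rtrancl_map_prod_involution:
  assumes inv: "\<And>x. t (t x) = x"
  shows "(map_prod t t ` D)\<^sup>* `` {t u} = t ` (D\<^sup>* `` {u})"
proof -
  have le: "(t u, t v) \<in> (map_prod t t ` D)\<^sup>*" if "(u, v) \<in> D\<^sup>*" for u v D
    using that
  proof (induction rule: rtrancl_induct)
    case (step y z)
    then have "(t y, t z) \<in> map_prod t t ` D" by force
    with step show ?case by (metis rtrancl.rtrancl_into_rtrancl)
  qed simp
  have "v \<in> t ` (D\<^sup>* `` {u})" if "(t u, v) \<in> (map_prod t t ` D)\<^sup>*" for v
  proof -
    \<comment> \<open>Applying the involution twice restores \<open>D\<close>, so \<open>le\<close>
      for the image digraph gives the converse.\<close>
    have "map_prod t t ` map_prod t t ` D = D"
      by (simp add: image_image map_prod_def split_beta inv)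
    then have "(u, t v) \<in> D\<^sup>*"
      using le[OF that] by (simp add: inv)
    then show ?thesis
      by (metis Image_singleton_iff imageI inv)
  qed
  then show ?thesis using le[of u _ D] by auto
qed

abbreviation swap_next :: "int \<Rightarrow> int \<Rightarrow> int" where
  "swap_next a \<equiv> Transposition.transpose a (a + 1)"

abbreviation swap_next_rel :: "int \<Rightarrow> (int \<times> int) set \<Rightarrow> (int \<times> int) set" where
  "swap_next_rel a D \<equiv> map_prod (swap_next a) (swap_next a) ` D"

text \<open>The last assumption excludes that \<open>a\<close> and \<open>a + 1\<close> are the two largest elements of \<open>R\<close>.\<close>
lemma Max_swap_next:
  assumes "finite R" "R \<noteq> {}" and "a + 1 \<in> R \<Longrightarrow> \<exists>c \<in> R. a + 1 < c"
  shows "Max (swap_next a ` R) = swap_next a (Max R)"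
proof (rule Max_eqI)
  fix y assume "y \<in> swap_next a ` R"
  then obtain r where r: "r \<in> R" "y = swap_next a r" by auto
  then have "r \<le> Max R" using assms by simp
  \<comment> \<open>The only order that the transposition reverses inside an adjacent pair is that
    of \<open>a\<close> and \<open>a + 1\<close>; this could do harm only if \<open>a + 1\<close>
    were the maximum.\<close>
  moreover have "Max R \<noteq> a + 1"
    using assms by (metis Max_ge Max_in not_less)
  ultimately show "y \<le> swap_next a (Max R)"
    using r(2) by (auto simp: Transposition.transpose_def split: if_splits)
qed (use assms in auto)

text \<open>Whatever reaches \<open>a + 1\<close> also reaches the larger \<open>c\<close>, so
  \<open>a + 1\<close> is never a highest value and \<open>Max_swap_next\<close> applies.\<close>

lemma highest_reach_swap_next:
  assumes "finite D" and "(a + 1, c) \<in> D\<^sup>*" "a + 1 < c"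
  shows "highest_reach (swap_next_rel a D) (swap_next a u) = swap_next a (highest_reach D u)"
proof -
  have "highest_reach (swap_next_rel a D) (swap_next a u) = Max (swap_next a ` (D\<^sup>* `` {u}))"
    unfolding highest_reach_def by (simp add: rtrancl_map_prod_involution)
  also have "\<dots> = swap_next a (highest_reach D u)"
    unfolding highest_reach_def
    using assms by (intro Max_swap_next finite_reach) (auto intro: rtrancl_trans)
  finally show ?thesis .
qed

lemma swap_next_rel_eqI:
  assumes "\<And>u v. (u, v) \<in> R \<Longrightarrow> (swap_next a u, swap_next a v) \<in> R"
  shows "swap_next_rel a R = R"
proof
  show sub: "swap_next_rel a R \<subseteq> R" using assms by auto
  show "R \<subseteq> swap_next_rel a R"
  proof clarify
    fix u v assume "(u, v) \<in> R"
    from imageI[OF assms[OF this], of "map_prod (swap_next a) (swap_next a)"]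
    show "(u, v) \<in> swap_next_rel a R" by simp
  qed
qed

section \<open>Class sizes\<close>

definition class_sizes :: "'a set \<Rightarrow> ('a \<Rightarrow> 'b::linorder) \<Rightarrow> nat list" where
  "class_sizes V h =
     rev (sorted_list_of_multiset {#card {u \<in> V. h u = v}. v \<in># mset_set (h ` V)#})"

text \<open>\<open>t\<close> carries the class of \<open>v\<close> onto the class of
  \<open>r v\<close>, and injectivity of \<open>r\<close> keeps different classes apart.\<close>

lemma class_sizes_relabel:
  assumes "finite V" "bij_betw t V V" "inj_on r (h ` V)"
    and "\<And>u. u \<in> V \<Longrightarrow> h' (t u) = r (h u)"
  shows "class_sizes V h' = class_sizes V h"
proof -
  have V: "t ` V = V" using assms(2) by (simp add: bij_betw_def)
  have "h' ` V = h' ` t ` V" using V by simp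
  also have "\<dots> = r ` h ` V" using assms(4) by (force simp: image_image)
  finally have img: "h' ` V = r ` h ` V" .
  have "card {u \<in> V. h' u = r v} = card {u \<in> V. h u = v}" if "v \<in> h ` V" for v
  proof -
    have "{u \<in> V. h' u = r v} = t ` {u \<in> V. h u = v}"
    proof (intro equalityI subsetI)
      fix y assume y: "y \<in> {u \<in> V. h' u = r v}"
      then obtain u where u: "u \<in> V" "y = t u" using V by blast
      with y assms(4) have "r (h u) = r v" by simp
      with assms(3) u that have "h u = v" by (auto dest: inj_onD)
      with u show "y \<in> t ` {u \<in> V. h u = v}" by blast
    qed (use V assms(4) in auto)
    moreover have "inj_on t {u \<in> V. h u = v}"
      using assms(2) by (auto simp: bij_betw_def inj_on_def)
    ultimately show ?thesis by (simp add: card_image)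
  qed
  note card = this
  have "mset_set (h' ` V) = image_mset r (mset_set (h ` V))"
    using assms(3) by (simp add: img image_mset_mset_set)
  then have "{#card {u \<in> V. h' u = v}. v \<in># mset_set (h' ` V)#}
      = {#card {u \<in> V. h' u = r v}. v \<in># mset_set (h ` V)#}"
    by (simp add: image_mset.compositionality o_def)
  also have "\<dots> = {#card {u \<in> V. h u = v}. v \<in># mset_set (h ` V)#}"
    using assms(1) by (intro image_mset_cong card) simp
  finally have "{#card {u \<in> V. h' u = v}. v \<in># mset_set (h' ` V)#}
      = {#card {u \<in> V. h u = v}. v \<in># mset_set (h ` V)#}" .
  then show ?thesis by (simp add: class_sizes_def)
qed

section \<open>Swapping two adjacent vertices\<close>

text \<open>\<open>T\<close> stands for the strict edges shared by both paths, \<open>R\<close> for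
  the shared non-strict edges other than \<open>(a, b)\<close>. A subset \<open>X\<close> of
  \<open>R\<close> encodes an orientation of the latter.\<close>

locale swap_symmetric =
  fixes V :: "int set" and T R :: "(int \<times> int) set" and a b c :: int
  assumes vertices: "finite V" "a \<in> V" "b \<in> V"
    and b: "b = a + 1" and bc: "b < c"
    and finite: "finite T" "finite R"
    and ascending: "(u, v) \<in> T \<union> R \<Longrightarrow> u < v"
    and new_edges: "(a, b) \<notin> T \<union> R" "(b, c) \<notin> R"
    and swap_T: "swap_next_rel a T = T" and swap_R: "swap_next_rel a R = R"
begin

text \<open>\<open>E\<close> is meant to hold directed edges among \<open>a\<close>,
  \<open>b\<close>, \<open>c\<close>, including the descending pair \<open>(b, a)\<close> that
  arises by transposition.\<close>

definition sizes :: "(int \<times> int) set \<Rightarrow> (int \<times> int) set \<Rightarrow> nat list" where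
  "sizes X E = class_sizes V (highest_reach ((T \<union> X) \<union> E))"

lemma sizes_swap:
  assumes "X \<subseteq> R" "finite E" "(b, c) \<in> (T \<union> X \<union> E)\<^sup>*"
  shows "sizes (swap_next_rel a X) (swap_next_rel a E) = sizes X E"
  unfolding sizes_def
proof (rule class_sizes_relabel[where t = "swap_next a" and r = "swap_next a"])
  show "bij_betw (swap_next a) V V"
    using vertices b by (intro bij_betw_byWitness[where f' = "swap_next a"])
      (auto simp: Transposition.transpose_def)
  show "highest_reach (T \<union> swap_next_rel a X \<union> swap_next_rel a E) (swap_next a u)
      = swap_next a (highest_reach (T \<union> X \<union> E) u)" for u
    using highest_reach_swap_next[of "T \<union> X \<union> E" a c u] assms bc b finite
    by (auto simp: image_Un swap_T finite_subset)
  show "inj_on (swap_next a) (highest_reach (T \<union> X \<union> E) ` V)"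
    by (metis inj_on_def transpose_involutory)
qed (use vertices in simp)

context
  fixes X assumes X: "X \<subseteq> R"
begin

lemma finite_X: "finite (T \<union> X)"
  using X finite by (auto simp: finite_subset)

lemma ascending_X: "(u, v) \<in> T \<Longrightarrow> u < v" "(u, v) \<in> X \<Longrightarrow> u < v"
  using X ascending by blast+

text \<open>Edges ascend and \<open>(a, b)\<close> is excluded, so both vertices lead directly into
  the range above \<open>b\<close>.\<close>

lemma succ_X:
  assumes "u \<in> {a, b}"
  shows "(u, v) \<in> T \<Longrightarrow> b < v" "(u, v) \<in> X \<Longrightarrow> b < v"
  using ascending_X[of u v] assms new_edges X b by (cases "v = b"; auto)+

text \<open>Ascending walks that start above \<open>b\<close> never return to \<open>a\<close> or
  \<open>b\<close>, where the edges of \<open>E\<close> begin.\<close>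

lemma highest_reach_above:
  assumes "E \<subseteq> {a, b} \<times> UNIV" "finite E" "b < u"
  shows "highest_reach (T \<union> X \<union> E) u = highest_reach (T \<union> X) u"
  by (rule highest_reach_cong[where Z = "{b<..}" and K = "{}"])
    (use assms finite_X b in \<open>auto dest: ascending_X\<close>)

lemma highest_reach_at:
  assumes "E \<subseteq> {a, b} \<times> UNIV" "finite E" "u \<in> {a, b}"
  shows "highest_reach (T \<union> X \<union> E) u
    = Max (insert (highest_reach (T \<union> X) u) (highest_reach (T \<union> X \<union> E) ` (E `` {u})))"
  using assms succ_X[OF assms(3)]
  by (intro highest_reach_union finite_X highest_reach_above) auto

text \<open>All other vertices have the same ascending successors in both digraphs, so the values at
  \<open>a\<close> and \<open>b\<close> determine the rest.\<close>

lemma sizes_eqI: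
  assumes "E \<subseteq> {a, b} \<times> UNIV" "finite E" "E' \<subseteq> {a, b} \<times> UNIV" "finite E'"
    and "highest_reach (T \<union> X \<union> E) a = highest_reach (T \<union> X \<union> E') a"
    and "highest_reach (T \<union> X \<union> E) b = highest_reach (T \<union> X \<union> E') b"
  shows "sizes X E = sizes X E'"
proof -
  have "highest_reach (T \<union> X \<union> E) u = highest_reach (T \<union> X \<union> E') u" for u
    by (rule highest_reach_cong[where Z = UNIV and K = "{a, b}"])
      (use assms finite_X in \<open>auto dest: ascending_X\<close>)
  then have "highest_reach (T \<union> X \<union> E) = highest_reach (T \<union> X \<union> E')" by (rule ext)
  then show ?thesis by (simp add: sizes_def)
qed

text \<open>The terms with an edge \<open>(b, a)\<close> are the transposes of those with \<open>(a, b)\<close>.\<close>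
lemma sizes_relations:
  fixes f :: "nat list \<Rightarrow> 'r::comm_ring_1"
  shows "sizes X {(a, b), (b, c), (a, c)} = sizes X {(a, b), (b, c)}"
    and "f (sizes X {(a, b), (a, c)}) + f (sizes X {(b, a), (b, c)})
          + 2 * f (sizes X {(a, c), (b, c)})
        = f (sizes X {(a, b), (b, c)}) + f (sizes X {(b, a), (a, c)})
          + f (sizes X {(b, c)}) + f (sizes X {(a, c)})"
proof -
  define hr where "hr E = highest_reach (T \<union> X \<union> E)" for E
  define A B C where "A = hr {} a" and "B = hr {} b" and "C = hr {} c"
  have c: "hr E c = C" if "E \<subseteq> {a, b} \<times> UNIV" "finite E" for E
    using that highest_reach_above[of E c] bc by (simp add: hr_def C_def)
  have hr: "hr E u = Max (insert (hr {} u) (hr E ` (E `` {u})))"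
    if "E \<subseteq> {a, b} \<times> UNIV" "finite E" "u \<in> {a, b}" for E u
    using that highest_reach_at[of E u] by (simp add: hr_def)
  have ab: "a \<noteq> b" "a \<noteq> c" "b \<noteq> c" using b bc by auto
  have img: "{(a, b), (a, c)} `` {a} = {b, c}" "{(a, b), (a, c)} `` {b} = {}"
    "{(b, a), (b, c)} `` {a} = {}" "{(b, a), (b, c)} `` {b} = {a, c}"
    "{(a, c), (b, c)} `` {a} = {c}" "{(a, c), (b, c)} `` {b} = {c}"
    "{(a, b), (b, c)} `` {a} = {b}" "{(a, b), (b, c)} `` {b} = {c}"
    "{(b, a), (a, c)} `` {a} = {c}" "{(b, a), (a, c)} `` {b} = {a}"
    "{(b, c)} `` {a} = {}" "{(b, c)} `` {b} = {c}"
    "{(a, c)} `` {a} = {c}" "{(a, c)} `` {b} = {}"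
    "{(a, b), (b, c), (a, c)} `` {a} = {b, c}" "{(a, b), (b, c), (a, c)} `` {b} = {c}"
    using ab by auto
  have v1: "hr {(a, b), (b, c), (a, c)} b = max B C"
      "hr {(a, b), (b, c), (a, c)} a = max A (max B C)"
    by (simp_all add: hr[of "{(a, b), (b, c), (a, c)}"] img c A_def[symmetric] B_def[symmetric])
  have v2: "hr {(a, b), (a, c)} b = B" "hr {(a, b), (a, c)} a = max A (max B C)"
    by (simp_all add: hr[of "{(a, b), (a, c)}"] img c A_def[symmetric] B_def[symmetric])
  have v2': "hr {(b, a), (b, c)} a = A" "hr {(b, a), (b, c)} b = max B (max A C)"
    by (simp_all add: hr[of "{(b, a), (b, c)}"] img c A_def[symmetric] B_def[symmetric])
  have v3: "hr {(a, c), (b, c)} a = max A C" "hr {(a, c), (b, c)} b = max B C"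
    by (simp_all add: hr[of "{(a, c), (b, c)}"] img c A_def[symmetric] B_def[symmetric])
  have v5: "hr {(a, b), (b, c)} b = max B C" "hr {(a, b), (b, c)} a = max A (max B C)"
    by (simp_all add: hr[of "{(a, b), (b, c)}"] img c A_def[symmetric] B_def[symmetric])
  have v5': "hr {(b, a), (a, c)} a = max A C" "hr {(b, a), (a, c)} b = max B (max A C)"
    by (simp_all add: hr[of "{(b, a), (a, c)}"] img c A_def[symmetric] B_def[symmetric])
  have v6: "hr {(b, c)} a = A" "hr {(b, c)} b = max B C"
    by (simp_all add: hr[of "{(b, c)}"] img c A_def[symmetric] B_def[symmetric])
  have v6': "hr {(a, c)} a = max A C" "hr {(a, c)} b = B"
    by (simp_all add: hr[of "{(a, c)}"] img c A_def[symmetric] B_def[symmetric])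
  note v = v1 v2 v2' v3 v5 v5' v6 v6'
  have eq: "sizes X E = sizes X E'" if "hr E a = hr E' a \<and> hr E b = hr E' b"
    "E \<subseteq> {a, b} \<times> UNIV \<and> finite E" "E' \<subseteq> {a, b} \<times> UNIV \<and> finite E'" for E E'
    using that by (intro sizes_eqI) (auto simp: hr_def)
  \<comment> \<open>The edge \<open>(a, c)\<close> adds nothing, since \<open>a\<close> reaches
    \<open>c\<close> through \<open>b\<close>.\<close>
  show "sizes X {(a, b), (b, c), (a, c)} = sizes X {(a, b), (b, c)}"
    by (rule eq) (auto simp: v)
  \<comment> \<open>In each case the two copies of \<open>{(a, c), (b, c)}\<close> match two
    different terms on the right. The last two cases are mirror images under exchange of
    \<open>a\<close> and \<open>b\<close>.\<close>
  consider "A \<le> C" "B \<le> C" | "A \<le> B" "C \<le> B" | "B \<le> A" "C \<le> A" by linarith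
  then show "f (sizes X {(a, b), (a, c)}) + f (sizes X {(b, a), (b, c)})
          + 2 * f (sizes X {(a, c), (b, c)})
        = f (sizes X {(a, b), (b, c)}) + f (sizes X {(b, a), (a, c)})
          + f (sizes X {(b, c)}) + f (sizes X {(a, c)})"
  proof cases
    case 1
    have "sizes X {(a, b), (a, c)} = sizes X {(a, c)}"
      "sizes X {(b, a), (b, c)} = sizes X {(b, c)}"
      "sizes X {(a, b), (b, c)} = sizes X {(a, c), (b, c)}"
      "sizes X {(b, a), (a, c)} = sizes X {(a, c), (b, c)}"
      by (rule eq; use 1 in \<open>auto simp: v\<close>)+
    then show ?thesis by (simp add: algebra_simps)
  next
    case 2
    have "sizes X {(a, b), (a, c)} = sizes X {(a, b), (b, c)}"
      "sizes X {(b, a), (b, c)} = sizes X {(b, c)}"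
      "sizes X {(b, a), (a, c)} = sizes X {(a, c), (b, c)}"
      "sizes X {(a, c)} = sizes X {(a, c), (b, c)}"
      by (rule eq; use 2 in \<open>auto simp: v\<close>)+
    then show ?thesis by (simp add: algebra_simps)
  next
    case 3
    have "sizes X {(a, b), (a, c)} = sizes X {(a, c)}"
      "sizes X {(b, a), (b, c)} = sizes X {(b, a), (a, c)}"
      "sizes X {(a, b), (b, c)} = sizes X {(a, c), (b, c)}"
      "sizes X {(b, c)} = sizes X {(a, c), (b, c)}"
      by (rule eq; use 3 in \<open>auto simp: v\<close>)+
    then show ?thesis by (simp add: algebra_simps)
  qed
qed

end

section \<open>Sums over the subsets of \<open>R\<close>\<close>

lemma sum_swap:
  "(\<Sum>X\<in>Pow R. h (swap_next_rel a X)) = (\<Sum>X\<in>Pow R. h X)"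
proof -
  have "swap_next_rel a X \<subseteq> R" if "X \<subseteq> R" for X
    using image_mono[OF that, of "map_prod (swap_next a) (swap_next a)"] swap_R by simp
  then show ?thesis
    by (intro sum.reindex_bij_witness[where i = "swap_next_rel a" and j = "swap_next_rel a"])
      (simp_all add: image_image map_prod_def split_beta)
qed

lemma card_swap: "card (swap_next_rel a X) = card X"
  by (intro card_image inj_on_subset[OF map_prod_inj_on[of _ UNIV _ UNIV]])
    (auto intro: inj_onI dest: injD[OF inj_swap])

text \<open>Reindexing by the transposed \<open>X\<close> preserves cardinalities. As
  \<open>E\<close> alone connects \<open>b\<close> to \<open>c\<close>, \<open>sizes_swap\<close>
  applies to every \<open>X\<close>.\<close>

lemma sum_sizes_swap:
  fixes f :: "nat list \<Rightarrow> 'r::comm_ring_1"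
  assumes "finite E" "(b, c) \<in> E\<^sup>*"
  shows "(\<Sum>X\<in>Pow R. q ^ card X * f (sizes X (swap_next_rel a E)))
    = (\<Sum>X\<in>Pow R. q ^ card X * f (sizes X E))"
proof -
  have "(\<Sum>X\<in>Pow R. q ^ card X * f (sizes X (swap_next_rel a E)))
      = (\<Sum>X\<in>Pow R. q ^ card (swap_next_rel a X) * f (sizes (swap_next_rel a X) (swap_next_rel a E)))"
    by (rule sum_swap[symmetric])
  also have "\<dots> = (\<Sum>X\<in>Pow R. q ^ card X * f (sizes X E))"
    using assms rtrancl_mono[of E "T \<union> X \<union> E" for X]
    by (intro sum.cong refl) (subst sizes_swap, auto simp: card_swap)
  finally show ?thesis .
qed

lemma sum_relation:
  fixes f :: "nat list \<Rightarrow> 'r::{idom,ring_char_0}" and q :: 'r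
  defines "S \<equiv> \<lambda>E. \<Sum>X\<in>Pow R. q ^ card X * f (sizes X E)"
  shows "q ^ 2 * S {(a, b), (b, c), (a, c)} + q * S {(a, b), (a, c)} + q * S {(a, c), (b, c)}
      + S {(a, c)} = (q + 1) * (q * S {(a, b), (b, c)} + S {(b, c)})"
proof -
  have swap: "S (swap_next_rel a E) = S E" if "finite E" "(b, c) \<in> E\<^sup>*" for E
    unfolding S_def by (rule sum_sizes_swap[OF that])
  have 1: "S {(a, b), (b, c), (a, c)} = S {(a, b), (b, c)}"
    unfolding S_def by (intro sum.cong refl) (simp add: sizes_relations(1))
  \<comment> \<open>\<open>swap\<close> requires that \<open>b\<close> reaches \<open>c\<close>, so
    it starts from \<open>{(b, a), (b, c)}\<close>.\<close>
  have 2: "S {(a, b), (a, c)} = S {(b, a), (b, c)}"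
    using swap[of "{(b, a), (b, c)}", OF _ r_into_rtrancl] b bc by (simp add: Transposition.transpose_def)
  have 5: "S {(a, b), (b, c)} = S {(b, a), (a, c)}"
    using swap[of "{(b, a), (a, c)}", OF _ rtrancl_trans[OF r_into_rtrancl r_into_rtrancl, of b a]] b bc
    by (simp add: Transposition.transpose_def)
  have 6: "S {(a, c)} = S {(b, c)}"
    using swap[of "{(b, c)}", OF _ r_into_rtrancl] b bc by (simp add: Transposition.transpose_def)
  have "S {(a, b), (a, c)} + S {(b, a), (b, c)} + 2 * S {(a, c), (b, c)}
      = S {(a, b), (b, c)} + S {(b, a), (a, c)} + S {(b, c)} + S {(a, c)}"
    unfolding S_def sum_distrib_left sum.distrib[symmetric]
  proof (intro sum.cong refl)
    fix X assume "X \<in> Pow R"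
    then show "q ^ card X * f (sizes X {(a, b), (a, c)}) + q ^ card X * f (sizes X {(b, a), (b, c)})
          + 2 * (q ^ card X * f (sizes X {(a, c), (b, c)}))
        = q ^ card X * f (sizes X {(a, b), (b, c)}) + q ^ card X * f (sizes X {(b, a), (a, c)})
          + q ^ card X * f (sizes X {(b, c)}) + q ^ card X * f (sizes X {(a, c)})"
      using arg_cong[OF sizes_relations(2)[of X f], of "(*) (q ^ card X)"]
      by (simp add: algebra_simps)
  qed
  \<comment> \<open>Transposed terms have equal sums, so the symmetrised identity is twice the
    desired one; the factor 2 cancels in a domain of characteristic 0.\<close>
  then have "2 * (S {(a, b), (a, c)} + S {(a, c), (b, c)})
      = 2 * (S {(a, b), (b, c)} + S {(b, c)})"
    using 2 5 6 by (simp add: algebra_simps)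
  then have "S {(a, b), (a, c)} + S {(a, c), (b, c)} = S {(a, b), (b, c)} + S {(b, c)}"
    by (metis mult_cancel_left zero_neq_numeral)
  then show ?thesis
    unfolding 1 6 by (simp add: algebra_simps power2_eq_square flip: distrib_left)
qed

lemma sum_Pow_insert:
  assumes "finite A" "e \<notin> A"
  shows "(\<Sum>X\<in>Pow (insert e A). g X) = (\<Sum>X\<in>Pow A. g X + g (insert e X))"
proof -
  have "inj_on (insert e) (Pow A)" using assms(2) by (auto simp: inj_on_def)
  moreover have "Pow A \<inter> insert e ` Pow A = {}" using assms(2) by auto
  ultimately show ?thesis
    using assms(1) by (simp add: Pow_insert sum.union_disjoint sum.reindex sum.distrib)
qed

text \<open>Splitting the subsets by their members among \<open>(a, b)\<close> and
  \<open>(b, c)\<close> yields the sums of \<open>sum_relation\<close>. Each of these members gives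
  a factor \<open>q\<close>; the strict edge gives none.\<close>

lemma sum_Pow_relation:
  fixes f :: "nat list \<Rightarrow> 'r::{idom,ring_char_0}" and q :: 'r
  shows "(\<Sum>X\<in>Pow (insert (a, b) (insert (b, c) R)).
        q ^ card X * f (class_sizes V (highest_reach (insert (a, c) T \<union> X))))
    = (q + 1) * (\<Sum>X\<in>Pow (insert (a, b) R).
        q ^ card X * f (class_sizes V (highest_reach (insert (b, c) T \<union> X))))"
proof -
  have ne: "(a, b) \<notin> insert (b, c) R" "(b, c) \<notin> R" "(a, b) \<notin> R"
    using new_edges b by auto
  have card: "card (insert (a, b) X) = Suc (card X)" "card (insert (b, c) X) = Suc (card X)"
    "card (insert (a, b) (insert (b, c) X)) = Suc (Suc (card X))" if "X \<in> Pow R" for X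
  proof -
    have "finite X" "(a, b) \<notin> insert (b, c) X" "(b, c) \<notin> X"
      using that ne finite by (auto simp: finite_subset)
    then show "card (insert (a, b) X) = Suc (card X)" "card (insert (b, c) X) = Suc (card X)"
      "card (insert (a, b) (insert (b, c) X)) = Suc (Suc (card X))"
      by simp_all
  qed
  have sz: "class_sizes V (highest_reach (insert (a, c) T \<union> insert (a, b) (insert (b, c) X)))
        = sizes X {(a, b), (b, c), (a, c)}"
      "class_sizes V (highest_reach (insert (a, c) T \<union> insert (a, b) X)) = sizes X {(a, b), (a, c)}"
      "class_sizes V (highest_reach (insert (a, c) T \<union> insert (b, c) X)) = sizes X {(a, c), (b, c)}"
      "class_sizes V (highest_reach (insert (a, c) T \<union> X)) = sizes X {(a, c)}"
      "class_sizes V (highest_reach (insert (b, c) T \<union> insert (a, b) X)) = sizes X {(a, b), (b, c)}"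
      "class_sizes V (highest_reach (insert (b, c) T \<union> X)) = sizes X {(b, c)}" if "X \<in> Pow R" for X
    unfolding sizes_def by (rule arg_cong[where f = "\<lambda>D. class_sizes V (highest_reach D)"]; blast)+
  have "(\<Sum>X\<in>Pow (insert (a, b) (insert (b, c) R)).
        q ^ card X * f (class_sizes V (highest_reach (insert (a, c) T \<union> X))))
      = (\<Sum>X\<in>Pow R. q ^ 2 * (q ^ card X * f (sizes X {(a, b), (b, c), (a, c)}))
          + q * (q ^ card X * f (sizes X {(a, b), (a, c)}))
          + q * (q ^ card X * f (sizes X {(a, c), (b, c)}))
          + q ^ card X * f (sizes X {(a, c)}))"
    unfolding sum_Pow_insert[OF finite.insertI[OF finite(2)] ne(1)] sum_Pow_insert[OF finite(2) ne(2)]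
    by (rule sum.cong[OF refl]) (simp only: card sz, simp add: algebra_simps power2_eq_square)
  also have "\<dots> = (q + 1) * (\<Sum>X\<in>Pow R. q * (q ^ card X * f (sizes X {(a, b), (b, c)}))
        + q ^ card X * f (sizes X {(b, c)}))"
    using sum_relation[of q f] by (simp add: sum.distrib sum_distrib_left)
  also have "(\<Sum>X\<in>Pow R. q * (q ^ card X * f (sizes X {(a, b), (b, c)}))
        + q ^ card X * f (sizes X {(b, c)}))
      = (\<Sum>X\<in>Pow (insert (a, b) R).
        q ^ card X * f (class_sizes V (highest_reach (insert (b, c) T \<union> X))))"
    unfolding sum_Pow_insert[OF finite(2) ne(3)]
    by (rule sum.cong[OF refl]) (simp only: card sz, simp add: algebra_simps)
  finally show ?thesis .
qed

end

section \<open>Reduction to sums over sets of ascending edges\<close>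

text \<open>Representing each edge by its upward pair lets sets of edges serve directly as
  digraphs.\<close>

definition ascending_pairs :: "int set set \<Rightarrow> (int \<times> int) set" where
  "ascending_pairs E = {(u, v). u < v \<and> {u, v} \<in> E}"

lemma edges_irrefl: "{u, u} \<notin> edges P"
  by (auto simp: edges_def nonstrict_edges_def strict_edges_def doubleton_eq_iff)

text \<open>Disjointness matters because an edge of both kinds would be forced upwards and could not
  be left out of \<open>X\<close>.\<close>

lemma LLTe_eq_sum:
  assumes disj: "ascending_pairs (nonstrict_edges P) \<inter> ascending_pairs (strict_edges P) = {}"
  shows "LLTe P t M = (\<Sum>X\<in>Pow (ascending_pairs (nonstrict_edges P)). (t - 1) ^ card X *
    elem_sym_partition
      (class_sizes (vertices P) (highest_reach (ascending_pairs (strict_edges P) \<union> X))) M)"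
proof -
  define N S where "N = ascending_pairs (nonstrict_edges P)" and "S = ascending_pairs (strict_edges P)"
  \<comment> \<open>The inverse of \<open>ascending_edges\<close>: strict edges point up, non-strict
    edges outside \<open>X\<close> point down.\<close>
  define orient where "orient X = S \<union> X \<union> {(v, u). (u, v) \<in> N - X}" for X
  have strictD: "(u :: int, v) \<in> \<theta> \<and> (v, u) \<notin> \<theta>" if "\<theta> \<in> path_orientations P" "(u, v) \<in> S" for \<theta> u v
    using that unfolding path_orientations_def orientations_def S_def ascending_pairs_def edges_def
    by blast
  have edge: "{u, v} \<in> edges P \<longleftrightarrow> (u, v) \<in> N \<union> S \<or> (v, u) \<in> N \<union> S" for u v
  proof -
    have "u \<noteq> v" if "{u, v} \<in> edges P" using that edges_irrefl by auto
    moreover have "{u, v} = {v, u}" by auto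
    ultimately show ?thesis
      unfolding N_def S_def ascending_pairs_def
      using edges_def by (cases u v rule: linorder_cases) auto
  qed
  have asc_pairs: "u < v" if "(u, v) \<in> N \<union> S" for u v
    using that by (auto simp: N_def S_def ascending_pairs_def)
  have orient_in: "orient X \<in> path_orientations P" if X: "X \<subseteq> N" for X
  proof -
    have "{u, v} \<in> edges P" if "(u, v) \<in> orient X" for u v
      using that X unfolding edge orient_def by blast
    moreover have "((u, v) \<in> orient X) \<noteq> ((v, u) \<in> orient X)" if "{u, v} \<in> edges P" for u v
    proof -
      have *: "((u, v) \<in> orient X) \<noteq> ((v, u) \<in> orient X)" if "(u, v) \<in> N \<union> S" for u v
      proof -
        have "(v, u) \<notin> N \<union> S" using asc_pairs[of u v] asc_pairs[of v u] that by auto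
        then show ?thesis
          using that X disj unfolding orient_def N_def[symmetric] S_def[symmetric] by blast
      qed
      show ?thesis using that *[of u v] *[of v u] unfolding edge by blast
    qed
    moreover have "(u, v) \<in> orient X" if "u < v" "{u, v} \<in> strict_edges P" for u v
      using that by (simp add: orient_def S_def ascending_pairs_def)
    ultimately show ?thesis
      unfolding path_orientations_def orientations_def by blast
  qed
  have asc_eq: "ascending_edges P \<theta> = \<theta> \<inter> N" for \<theta>
    by (auto simp: ascending_edges_def N_def ascending_pairs_def)
  have "(\<Sum>\<theta>\<in>path_orientations P. (t - 1) ^ asc P \<theta> * elem_sym_partition (orientation_partition P \<theta>) M)
    = (\<Sum>X\<in>Pow N. (t - 1) ^ card X * elem_sym_partition (class_sizes (vertices P) (highest_reach (S \<union> X))) M)"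
  proof (rule sum.reindex_bij_witness[where i = orient and j = "ascending_edges P"])
    fix \<theta> assume \<theta>: "\<theta> \<in> path_orientations P"
    have edgeD: "(u, v) \<in> N \<union> S \<or> (v, u) \<in> N \<union> S" if "(u, v) \<in> \<theta>" for u v
      using that \<theta> unfolding edge[symmetric] path_orientations_def orientations_def by blast
    have xor: "((u, v) \<in> \<theta>) \<noteq> ((v, u) \<in> \<theta>)" if "(u, v) \<in> N \<union> S" for u v
    proof -
      have "{u, v} \<in> edges P" unfolding edge using that by blast
      then show ?thesis using \<theta> unfolding path_orientations_def orientations_def by blast
    qed
    show "orient (ascending_edges P \<theta>) = \<theta>"
    proof (intro set_eqI, clarify)
      fix u v
      show "(u, v) \<in> orient (ascending_edges P \<theta>) \<longleftrightarrow> (u, v) \<in> \<theta>"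
        using edgeD[of u v] xor[of u v] xor[of v u] strictD[OF \<theta>, of u v] strictD[OF \<theta>, of v u]
        unfolding orient_def asc_eq by blast
    qed
    show "ascending_edges P \<theta> \<in> Pow N"
      by (auto simp: asc_eq)
    \<comment> \<open>Every strict edge is present and points up, so \<open>hrv\<close> sees all of
      \<open>S\<close> whatever the orientation.\<close>
    have "{(a, b). (a, b) \<in> \<theta> \<and> {a, b} \<in> strict_edges P} = S"
    proof (intro set_eqI, clarify)
      fix u v
      show "(u, v) \<in> {(a, b). (a, b) \<in> \<theta> \<and> {a, b} \<in> strict_edges P} \<longleftrightarrow> (u, v) \<in> S"
      proof
        assume "(u, v) \<in> {(a, b). (a, b) \<in> \<theta> \<and> {a, b} \<in> strict_edges P}"
        then have uv: "(u, v) \<in> \<theta>" "{u, v} \<in> strict_edges P" by simp_all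
        have "\<not> v < u"
        proof
          assume "v < u"
          with uv(2) have "(v, u) \<in> S" by (simp add: S_def ascending_pairs_def insert_commute)
          then show False using strictD[OF \<theta>] uv(1) by blast
        qed
        moreover have "u \<noteq> v" using uv(2) edges_irrefl[of u P] by (auto simp: edges_def)
        ultimately show "(u, v) \<in> S" using uv(2) by (simp add: S_def ascending_pairs_def)
      qed (use strictD[OF \<theta>, of u v] in \<open>simp add: S_def ascending_pairs_def\<close>)
    qed
    then have "hrv P \<theta> = highest_reach (S \<union> ascending_edges P \<theta>)"
      by (intro ext) (simp add: hrv_def highest_reach_def Image_def)
    then show "(t - 1) ^ card (ascending_edges P \<theta>) *
        elem_sym_partition (class_sizes (vertices P) (highest_reach (S \<union> ascending_edges P \<theta>))) M
      = (t - 1) ^ asc P \<theta> * elem_sym_partition (orientation_partition P \<theta>) M"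
      by (simp add: asc_def orientation_partition_def class_sizes_def)
  next
    fix X assume X: "X \<in> Pow N"
    then show "orient X \<in> path_orientations P" by (simp add: orient_in)
    have "(v, u) \<notin> N" if "(u, v) \<in> N" for u v using asc_pairs[of u v] asc_pairs[of v u] that by auto
    then show "ascending_edges P (orient X) = X"
      using X disj unfolding asc_eq orient_def N_def[symmetric] S_def[symmetric] by blast
  qed
  then show ?thesis by (simp add: LLTe_def N_def S_def)
qed

section \<open>The steps of a path\<close>

lemma endpoint_Nil [simp]: "endpoint [] = 0"
  and endpoint_Cons [simp]: "endpoint (s # P) = step_vec s + endpoint P"
  and endpoint_append [simp]: "endpoint (P @ Q) = endpoint P + endpoint Q"
  by (simp_all add: endpoint_def)

lemma step_vec_nonneg: "0 \<le> fst (step_vec s)" "0 \<le> snd (step_vec s)"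
  by (cases s; simp)+

lemma endpoint_nonneg: "0 \<le> fst (endpoint P)" "0 \<le> snd (endpoint P)"
  by (induction P) (auto simp: step_vec_nonneg add_nonneg_nonneg)

lemma vertex_at_0 [simp]: "vertex_at P 0 = 0"
  by (simp add: vertex_at_def)

lemma vertex_at_Suc: "i < length P \<Longrightarrow> vertex_at P (Suc i) = vertex_at P i + step_vec (P ! i)"
  by (simp add: vertex_at_def take_Suc_conv_app_nth)

text \<open>Every step increases the sum of the coordinates.\<close>

lemma vertex_at_inj:
  assumes "vertex_at P i = vertex_at P j" "i \<le> length P" "j \<le> length P"
  shows "i = j"
proof -
  define m where "m i = fst (vertex_at P i) + snd (vertex_at P i)" for i
  have less: "m i < m j" if "i < j" "j \<le> length P" for i j
    using that
  proof (induction j)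
    case (Suc j)
    have "m j < m (Suc j)"
      using Suc.prems by (cases "P ! j") (simp_all add: m_def vertex_at_Suc)
    with Suc show ?case by (cases "i = j") auto
  qed simp
  show ?thesis
    using assms less[of i j] less[of j i] by (cases i j rule: linorder_cases) (auto simp: m_def)
qed

text \<open>The graph depends only on which steps start where; as sets, the steps of two paths can
  be compared through their common part.\<close>

fun steps_from :: "int \<times> int \<Rightarrow> step list \<Rightarrow> ((int \<times> int) \<times> step) set" where
  "steps_from p [] = {}"
| "steps_from p (s # P) = insert (p, s) (steps_from (p + step_vec s) P)"

lemma steps_from_append: "steps_from p (P @ Q) = steps_from p P \<union> steps_from (p + endpoint P) Q"
  by (induction P arbitrary: p) (auto simp: add.assoc)

lemma steps_from_conv_nth: "steps_from p P = (\<lambda>i. (p + vertex_at P i, P ! i)) ` {..<length P}"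
proof (induction P arbitrary: p)
  case (Cons s P)
  have "vertex_at (s # P) (Suc i) = step_vec s + vertex_at P i" for i
    by (simp add: vertex_at_def)
  then show ?case
    by (simp add: Cons lessThan_Suc_eq_insert_0 image_image add.assoc)
qed simp

lemma steps_from_0_iff: "(p, s) \<in> steps_from 0 P \<longleftrightarrow> (\<exists>i<length P. vertex_at P i = p \<and> P ! i = s)"
  by (auto simp: steps_from_conv_nth)

lemma steps_from_bounds:
  assumes "(p', s) \<in> steps_from p P"
  shows "fst p \<le> fst p'" "snd p \<le> snd p'"
    "fst p' + fst (step_vec s) \<le> fst p + fst (endpoint P)"
    "snd p' + snd (step_vec s) \<le> snd p + snd (endpoint P)"
  using assms
proof (induction P arbitrary: p)
  case (Cons r P)
  {
    case 1
    then show ?case using Cons.IH(1)[of "p + step_vec r"] step_vec_nonneg[of r] by auto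
  next
    case 2
    then show ?case using Cons.IH(2)[of "p + step_vec r"] step_vec_nonneg[of r] by auto
  next
    case 3
    then show ?case using Cons.IH(3)[of "p + step_vec r"] endpoint_nonneg[of P] by auto
  next
    case 4
    then show ?case using Cons.IH(4)[of "p + step_vec r"] endpoint_nonneg[of P] by auto
  }
qed simp_all

lemma fst_step_vec: "s \<noteq> North \<Longrightarrow> fst (step_vec s) = 1"
  by (cases s) auto

text \<open>An east or diagonal step moves to the next column, and the path never returns.\<close>

lemma steps_from_same_column:
  assumes "(p, s) \<in> steps_from o' P" "(p', s') \<in> steps_from o' P" "s \<noteq> North" "s' \<noteq> North" "fst p = fst p'"
  shows "p = p' \<and> s = s'"
  using assms
proof (induction P arbitrary: o')
  case (Cons r P)
  have "fst o' + fst (step_vec r) \<le> fst q" if "(q, t) \<in> steps_from (o' + step_vec r) P" for q t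
    using steps_from_bounds(1)[OF that] by simp
  with Cons show ?case by (fastforce simp: fst_step_vec)
qed simp

lemma endpoint_count_list:
  "fst (endpoint P) = int (count_list P East + count_list P Diag)"
  "snd (endpoint P) = int (count_list P North + count_list P Diag)"
proof (induction P)
  case (Cons s P)
  {
    case 1
    then show ?case using Cons by (cases s) auto
  next
    case 2
    then show ?case using Cons by (cases s) auto
  }
qed simp_all

text \<open>Diagonal steps add equally to both coordinates, so comparing north and east counts
  compares the coordinates.\<close>

lemma schroeder_path_iff:
  "schroeder_path n P \<longleftrightarrow> endpoint P = (int n, int n) \<and>
     (\<forall>(p, s)\<in>steps_from 0 P. s \<noteq> North \<longrightarrow> fst p < snd p)"
proof -
  have "count_list (take i P) North > count_list (take i P) East
      \<longleftrightarrow> fst (vertex_at P i) < snd (vertex_at P i)" for i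
    by (simp add: vertex_at_def endpoint_count_list)
  moreover have "s \<in> {East, Diag} \<longleftrightarrow> s \<noteq> North" for s by (cases s) auto
  ultimately show ?thesis
    unfolding schroeder_path_def steps_from_conv_nth by auto
qed

section \<open>The decorated graph in terms of the steps\<close>

lemma ascending_pairs_strict_edges:
  assumes "schroeder_path n P"
  shows "ascending_pairs (strict_edges P) = {(a, b). ((a - 1, b - 1), Diag) \<in> steps_from 0 P}"
proof -
  have "a < b \<and> a \<in> vertices P \<and> b \<in> vertices P \<and> (\<exists>i < length P. P ! i = Diag \<and>
           vertex_at P i = (a - 1, b - 1) \<and> vertex_at P (Suc i) = (a, b))"
    if step: "((a - 1, b - 1), Diag) \<in> steps_from 0 P" for a b
  proof -
    obtain i where i: "i < length P" "P ! i = Diag" "vertex_at P i = (a - 1, b - 1)"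
      using step by (auto simp: steps_from_0_iff)
    moreover have "vertex_at P (Suc i) = (a, b)" using i by (simp add: vertex_at_Suc)
    moreover have "endpoint P = (int n, int n)" "a < b"
      using assms step by (auto simp: schroeder_path_iff)
    ultimately show ?thesis
      using steps_from_bounds[OF step] unfolding vertices_def by auto
  qed
  note step = this
  show ?thesis
  proof (intro set_eqI iffI; clarify)
    fix a b assume "(a, b) \<in> ascending_pairs (strict_edges P)"
    then show "((a - 1, b - 1), Diag) \<in> steps_from 0 P"
      unfolding ascending_pairs_def strict_edges_def steps_from_0_iff
      by (auto simp: doubleton_eq_iff)
  next
    fix a b assume "((a - 1, b - 1), Diag) \<in> steps_from 0 P"
    from step[OF this] show "(a, b) \<in> ascending_pairs (strict_edges P)"
      unfolding ascending_pairs_def strict_edges_def by blast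
  qed
qed

text \<open>Only a step that is not north crosses the interior of a column. A diagonal one starting
  at height \<open>b - 1\<close> would cut the square, hence the bound on the starting
  height.\<close>

lemma square_subset_region_iff:
  assumes "a < b"
  shows "{real_of_int (a - 1)..real_of_int a} \<times> {real_of_int (b - 1)..real_of_int b} \<subseteq> region P
    \<longleftrightarrow> (\<exists>h s. ((a - 1, h), s) \<in> steps_from 0 P \<and> s \<noteq> North \<and> b \<le> h)" (is "?L \<longleftrightarrow> ?R")
proof
  txt \<open>Above \<open>a - 1 / 2\<close> there are no vertical steps, and rounding absorbs the half unit of a diagonal step.\<close>
  assume ?L
  moreover have "(real_of_int a - 1 / 2, real_of_int b) \<in>
      {real_of_int (a - 1)..real_of_int a} \<times> {real_of_int (b - 1)..real_of_int b}" by simp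
  ultimately have "(real_of_int a - 1 / 2, real_of_int b) \<in> region P" by blast
  then obtain t i where t: "real_of_int b \<le> t" and i: "i < length P"
    and seg: "(real_of_int a - 1 / 2, t) \<in>
      closed_segment (real_point (vertex_at P i)) (real_point (vertex_at P (Suc i)))"
    by (auto simp: region_def path_curve_def)
  obtain g h where gh: "vertex_at P i = (g, h)" by fastforce
  obtain \<mu> where \<mu>: "0 \<le> \<mu>" "\<mu> \<le> 1"
    "real_of_int a - 1 / 2 = real_of_int g + \<mu> * real_of_int (fst (step_vec (P ! i)))"
    "t = real_of_int h + \<mu> * real_of_int (snd (step_vec (P ! i)))"
    using seg i gh by (auto simp: in_segment real_point_def vertex_at_Suc algebra_simps)
  have not_int: "real_of_int a - 1 / 2 \<noteq> real_of_int k" for k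
  proof
    assume "real_of_int a - 1 / 2 = real_of_int k"
    then have "real_of_int (2 * a - 1) = real_of_int (2 * k)" by simp
    then have "2 * a - 1 = 2 * k" by (simp only: of_int_eq_iff)
    then show False by presburger
  qed
  have north: "P ! i \<noteq> North" using \<mu>(3) not_int[of g] by auto
  then have eq: "real_of_int a - 1 / 2 = real_of_int g + \<mu>" using \<mu>(3) by (simp add: fst_step_vec)
  have "\<mu> \<noteq> 0" "\<mu> \<noteq> 1" using eq not_int[of g] not_int[of "g + 1"] by auto
  then have "real_of_int g < real_of_int a - 1 / 2" "real_of_int a - 1 / 2 < real_of_int g + 1"
    using \<mu>(1,2) eq by auto
  then have g: "g = a - 1" by linarith
  then have "\<mu> = 1 / 2" using eq by simp
  then have "t \<le> real_of_int h + 1 / 2" using \<mu>(4) by (cases "P ! i") auto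
  then have "b \<le> h" using t by linarith
  then show ?R using i gh g north by (auto simp: steps_from_0_iff)
next
  assume ?R
  then obtain h i where i: "i < length P" "vertex_at P i = (a - 1, h)" "P ! i \<noteq> North" "b \<le> h"
    by (auto simp: steps_from_0_iff)
  show ?L
  proof clarify
    fix s t :: real
    assume s: "s \<in> {real_of_int (a - 1)..real_of_int a}" and t: "t \<in> {real_of_int (b - 1)..real_of_int b}"
    define \<mu> where "\<mu> = s - real_of_int (a - 1)"
    have \<mu>: "0 \<le> \<mu>" "\<mu> \<le> 1" using s by (auto simp: \<mu>_def)
    define k where "k = real_of_int (snd (step_vec (P ! i)))"
    have "(s, real_of_int h + \<mu> * k) \<in>
        closed_segment (real_point (vertex_at P i)) (real_point (vertex_at P (Suc i)))"
      unfolding in_segment using \<mu> i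
      by (intro exI[of _ \<mu>])
        (auto simp: real_point_def vertex_at_Suc fst_step_vec \<mu>_def k_def algebra_simps)
    then have "(s, real_of_int h + \<mu> * k) \<in> path_curve P"
      using i(1) unfolding path_curve_def by blast
    moreover have "0 \<le> \<mu> * k" using \<mu> step_vec_nonneg by (simp add: k_def)
    then have "t \<le> real_of_int h + \<mu> * k" using t i(4) by (auto simp: of_int_le_iff[symmetric] simp del: of_int_le_iff)
    moreover have "s \<le> t"
    proof -
      have "real_of_int a \<le> real_of_int (b - 1)" using assms by linarith
      then show ?thesis using s t by auto
    qed
    ultimately show "(s, t) \<in> region P" unfolding region_def by blast
  qed
qed

lemma ascending_pairs_nonstrict_edges:
  assumes "schroeder_path n P"
  shows "ascending_pairs (nonstrict_edges P) =
    {(a, b). a < b \<and> (\<exists>h s. ((a - 1, h), s) \<in> steps_from 0 P \<and> s \<noteq> North \<and> b \<le> h)}"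
proof -
  have "a \<in> vertices P \<and> b \<in> vertices P"
    if ab: "a < b" "b \<le> h" and step: "((a - 1, h), s) \<in> steps_from 0 P" and "s \<noteq> North" for a b h s
  proof -
    have "endpoint P = (int n, int n)" using assms by (simp add: schroeder_path_iff)
    then show ?thesis
      using steps_from_bounds[OF step] ab step_vec_nonneg[of s] fst_step_vec[OF \<open>s \<noteq> North\<close>]
      unfolding vertices_def by auto
  qed
  note vertices = this
  have edge: "{a, b} \<in> nonstrict_edges P \<longleftrightarrow> a \<in> vertices P \<and> b \<in> vertices P \<and>
      (\<exists>h s. ((a - 1, h), s) \<in> steps_from 0 P \<and> s \<noteq> North \<and> b \<le> h)" if "a < b" for a b
    using that unfolding nonstrict_edges_def square_subset_region_iff[OF that, symmetric]
    by (auto simp: doubleton_eq_iff simp del: of_int_diff)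
  show ?thesis
  proof (intro set_eqI iffI; clarify)
    fix a b assume "(a, b) \<in> ascending_pairs (nonstrict_edges P)"
    then show "a < b \<and> (\<exists>h s. ((a - 1, h), s) \<in> steps_from 0 P \<and> s \<noteq> North \<and> b \<le> h)"
      using edge unfolding ascending_pairs_def by blast
  next
    fix a b h s
    assume "a < b" "((a - 1, h), s) \<in> steps_from 0 P" "s \<noteq> North" "b \<le> h"
    then show "(a, b) \<in> ascending_pairs (nonstrict_edges P)"
      using edge vertices unfolding ascending_pairs_def by blast
  qed
qed

text \<open>The one crossing step of column \<open>a\<close> would start both at
  \<open>b - 1\<close> and at height at least \<open>b\<close>.\<close>

lemma disjoint_nonstrict_strict:
  assumes "schroeder_path n P"
  shows "ascending_pairs (nonstrict_edges P) \<inter> ascending_pairs (strict_edges P) = {}"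
proof -
  have False if N: "(a, b) \<in> ascending_pairs (nonstrict_edges P)"
    and S: "(a, b) \<in> ascending_pairs (strict_edges P)" for a b
  proof -
    from N obtain h s where "((a - 1, h), s) \<in> steps_from 0 P" "s \<noteq> North" "b \<le> h"
      unfolding ascending_pairs_nonstrict_edges[OF assms] by blast
    moreover from S have "((a - 1, b - 1), Diag) \<in> steps_from 0 P"
      unfolding ascending_pairs_strict_edges[OF assms] by blast
    ultimately show False
      using steps_from_same_column[of "(a - 1, h)" s 0 P "(a - 1, b - 1)" Diag] by simp
  qed
  then show ?thesis by auto
qed

section \<open>Bounce paths with one bounce point\<close>

text \<open>The path visits a point only once, so the two diagonal steps are the only ones incident
  to \<open>p\<close>.\<close>

lemma not_between_diagonals_and_incident:
  assumes "between_diagonals P p"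
  shows "\<not> incident_north_east P p"
proof
  assume "incident_north_east P p"
  then obtain j where j: "j < length P" "P ! j \<in> {North, East}"
    "vertex_at P j = p \<or> vertex_at P (Suc j) = p"
    by (auto simp: incident_north_east_def)
  obtain i where i: "Suc i < length P" "vertex_at P (Suc i) = p" "P ! i = Diag" "P ! Suc i = Diag"
    using assms by (auto simp: between_diagonals_def)
  have "j = Suc i \<or> Suc j = Suc i"
    using i j vertex_at_inj[of P j "Suc i"] vertex_at_inj[of P "Suc j" "Suc i"] by auto
  then show False using i j by auto
qed

lemma first_point_west_unique:
  "first_point_west P u v \<Longrightarrow> first_point_west P u w \<Longrightarrow> v = w"
  unfolding first_point_west_def by (metis linorder_less_linear)

text \<open>\<open>bounce_decomposition\<close> provides merely some bounce path. It must stop where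
  the given one does: the first point to the west is unique and cannot allow both stopping and
  continuing.\<close>

lemma bounce_path_single:
  assumes "bounce_path P (u, t) bs r" "length bs = 1" "bounce_path P (u, t) bs' r'"
  shows "snd r' = u"
proof -
  from assms(1) obtain v where v: "first_point_west P u v" "incident_north_east P (v, u)"
  proof cases
    case (bounce v bs'')
    then have "bs'' = []" using assms(2) by simp
    with bounce(4) show ?thesis by (auto elim: bounce_path.cases)
  qed auto
  from assms(3) show ?thesis
  proof cases
    case (bounce w bs'')
    then have "w = v" using v(1) first_point_west_unique by blast
    then show ?thesis using bounce v(2) not_between_diagonals_and_incident by blast
  qed auto
qed

section \<open>The bounce relation\<close>

theorem theorem5p4:
  fixes n :: nat and P Q U V W :: "step list" and x z :: int
    and bs :: "(int \<times> int) list" and r :: "int \<times> int"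
  assumes "schroeder_path n P"
    and "(x, z) \<in> lattice_points P"
    and "z > x + 1"
    and "bounce_path P (x, z) bs r" and "length bs = 1"
    and "bounce_decomposition P (x, z) U North North V Diag East W"
    and "Q = U @ [North, North] @ V @ [East, Diag] @ W"
  shows "LLTe P (qvar + 1) = (\<lambda>M. (qvar + 1) * LLTe Q (qvar + 1) M)"
proof
  fix M
  have P: "P = U @ [North] @ [North] @ V @ [Diag] @ [East] @ W"
    and end_xz: "endpoint (U @ [North] @ [North] @ V @ [Diag]) = (x, z)"
    and "\<exists>bs'. bounce_path P (x, z) bs' (endpoint (U @ [North]))"
    using assms(6) by (auto simp: bounce_decomposition_def)
  \<comment> \<open>The only bounce point is \<open>(x, x)\<close>, so the bounce path stops at
    height \<open>x\<close>, between the two north steps.\<close>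
  then have "snd (endpoint (U @ [North])) = x"
    using bounce_path_single[OF assms(4,5)] by blast
  then obtain y where U: "endpoint U = (y, x - 1)"
    by (cases "endpoint U") auto
  have V: "(y, x - 1) + ((0, 1) + ((0, 1) + endpoint V)) = (x - 1, z - 1)"
    using end_xz U by (cases "endpoint V") auto
  \<comment> \<open>The steps common to \<open>P\<close> and \<open>Q\<close>; \<open>V\<close>
    starts at \<open>(y, x + 1)\<close> and \<open>W\<close> at \<open>(x + 1, z)\<close>.\<close>
  define K where "K = steps_from 0 U \<union> {((y, x - 1), North), ((y, x), North)}
      \<union> steps_from (y, x + 1) V \<union> steps_from (x + 1, z) W"
  have V': "(y, x + 1) + endpoint V = (x - 1, z - 1)"
    using V by (cases "endpoint V") auto
  have stepsP: "steps_from 0 P = K \<union> {((x - 1, z - 1), Diag), ((x, z), East)}"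
    unfolding P K_def by (auto simp: steps_from_append U V')
  have stepsQ: "steps_from 0 Q = K \<union> {((x - 1, z - 1), East), ((x, z - 1), Diag)}"
    unfolding assms(7) K_def by (auto simp: steps_from_append U V')
  have endQ: "endpoint Q = endpoint P"
    unfolding P assms(7) by simp
  \<comment> \<open>The new diagonal step starts at \<open>(x, z - 1)\<close>, strictly above the
    diagonal because \<open>z > x + 1\<close>.\<close>
  have Q: "schroeder_path n Q"
    using assms(1,3) unfolding schroeder_path_iff endQ stepsP stepsQ by auto
  \<comment> \<open>The exchanged steps alone cross the columns of the vertices \<open>x\<close> and
    \<open>x + 1\<close>. As height \<open>x\<close> is passed between north steps, no common east
    or diagonal step starts there and no common diagonal step ends there.\<close>
  have K: "fst p \<noteq> x - 1" "fst p \<noteq> x" "snd p \<noteq> x" "s = Diag \<Longrightarrow> snd p \<noteq> x - 1"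
    if step: "(p, s) \<in> K" "s \<noteq> North" for p s
  proof -
    have s: "fst (step_vec s) = 1" using step(2) by (rule fst_step_vec)
    have Vb: "y + fst (endpoint V) = x - 1"
      using V' by (cases "endpoint V") simp
    consider "fst p + 1 \<le> x - 1" "snd p + snd (step_vec s) \<le> x - 1"
      | "fst p + 1 \<le> x - 1" "x + 1 \<le> snd p" | "x + 1 \<le> fst p" "x + 1 \<le> snd p"
    proof -
      have "(p, s) \<in> steps_from 0 U \<or> (p, s) \<in> steps_from (y, x + 1) V
          \<or> (p, s) \<in> steps_from (x + 1, z) W"
        using step by (auto simp: K_def)
      then show thesis
      proof (elim disjE)
        assume "(p, s) \<in> steps_from 0 U"
        note bounds = steps_from_bounds(3,4)[OF this]
        have "y \<le> x - 1" using Vb endpoint_nonneg(1)[of V] by simp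
        then show thesis using bounds U s by (intro that(1)) auto
      next
        assume "(p, s) \<in> steps_from (y, x + 1) V"
        note bounds = steps_from_bounds(2,3)[OF this]
        show thesis using bounds Vb s by (intro that(2)) auto
      next
        assume "(p, s) \<in> steps_from (x + 1, z) W"
        note bounds = steps_from_bounds(1,2)[OF this]
        show thesis using bounds assms(3) by (intro that(3)) auto
      qed
    qed
    then show "fst p \<noteq> x - 1" "fst p \<noteq> x" "snd p \<noteq> x" "s = Diag \<Longrightarrow> snd p \<noteq> x - 1"
      using step_vec_nonneg(2)[of s] by (cases; auto)+
  qed
  define T where "T = {(a, b). ((a - 1, b - 1), Diag) \<in> K}"
  define F where "F a b \<longleftrightarrow> (\<exists>h s. ((a - 1, h), s) \<in> K \<and> s \<noteq> North \<and> b \<le> h)" for a b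
  \<comment> \<open>In both paths the exchanged steps join \<open>x\<close> and \<open>x + 1\<close>
    to all of \<open>x + 2\<close>, ..., \<open>z - 1\<close>; the east step of \<open>P\<close> at
    height \<open>z\<close> adds \<open>(x + 1, z)\<close>.\<close>
  define R where "R = {(a, b). a < b \<and> F a b} \<union> {x, x + 1} \<times> {x + 2..z - 1}"
  have ex_insert: "(\<exists>h s. ((a - 1, h), s) \<in> K \<union> {((g, k), t), ((g', k'), t')} \<and> s \<noteq> North \<and> b \<le> h)
      \<longleftrightarrow> F a b \<or> a = g + 1 \<and> t \<noteq> North \<and> b \<le> k \<or> a = g' + 1 \<and> t' \<noteq> North \<and> b \<le> k'"
    for a b g k t g' k' t'
  proof -
    have "a = g + 1 \<longleftrightarrow> a - 1 = g" for g by auto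
    then show ?thesis unfolding F_def by (simp only: Un_iff insert_iff empty_iff prod.inject) blast
  qed
  have NP: "ascending_pairs (nonstrict_edges P) = insert (x, x + 1) (insert (x + 1, z) R)"
    unfolding ascending_pairs_nonstrict_edges[OF assms(1)] R_def stepsP ex_insert
    using assms(3) by auto
  have NQ: "ascending_pairs (nonstrict_edges Q) = insert (x, x + 1) R"
    unfolding ascending_pairs_nonstrict_edges[OF Q] R_def stepsQ ex_insert
    using assms(3) by auto
  have SP: "ascending_pairs (strict_edges P) = insert (x, z) T"
    unfolding ascending_pairs_strict_edges[OF assms(1)] stepsP T_def by auto
  have SQ: "ascending_pairs (strict_edges Q) = insert (x + 1, z) T"
    unfolding ascending_pairs_strict_edges[OF Q] stepsQ T_def by auto
  have ver: "vertices Q = vertices P" by (simp add: vertices_def endQ)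
  have pairs_subset: "ascending_pairs E \<subseteq> vertices P \<times> vertices P" if "E \<subseteq> edges P" for E
  proof -
    have "u \<in> vertices P \<and> v \<in> vertices P" if "{u, v} \<in> edges P" for u v
      using that unfolding edges_def nonstrict_edges_def strict_edges_def
      by (elim UnE CollectE exE conjE) (auto simp only: doubleton_eq_iff)
    then show ?thesis using that unfolding ascending_pairs_def by blast
  qed
  have finite_vertices: "finite (vertices P)" by (simp add: vertices_def)
  have xz: "x \<in> vertices P" "x + 1 \<in> vertices P"
    using pairs_subset[of "nonstrict_edges P"] unfolding NP edges_def by auto
  have finite_pairs: "finite (ascending_pairs E)" if "E \<subseteq> edges P" for E
    using finite_subset[OF pairs_subset[OF that]] finite_vertices by simp
  interpret swap_symmetric "vertices P" T R x "x + 1" z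
  proof
    show "finite T" "finite R"
      using finite_pairs[of "nonstrict_edges P"] finite_pairs[of "strict_edges P"]
      unfolding NP SP edges_def by auto
    show "u < v" if "(u, v) \<in> T \<union> R" for u v
      using that NP SP unfolding ascending_pairs_def by blast
    have "\<not> F x b" "\<not> F (x + 1) b" for b
      unfolding F_def using K(1,2) by fastforce+
    then show "(x, x + 1) \<notin> T \<union> R" "(x + 1, z) \<notin> R"
      unfolding T_def R_def using K(1)[of "(x - 1, x)" Diag] by auto
    show "swap_next_rel x T = T"
    proof (rule swap_next_rel_eqI)
      fix u v assume uv: "(u, v) \<in> T"
      then have "u \<noteq> x" "u \<noteq> x + 1" "v \<noteq> x" "v \<noteq> x + 1"
        using K[of "(u - 1, v - 1)" Diag] by (auto simp: T_def)
      with uv show "(swap_next x u, swap_next x v) \<in> T" by simp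
    qed
    show "swap_next_rel x R = R"
    proof (rule swap_next_rel_eqI)
      fix u v assume "(u, v) \<in> R"
      then consider h s where "u < v" "((u - 1, h), s) \<in> K" "s \<noteq> North" "v \<le> h"
        | "u \<in> {x, x + 1}" "v \<in> {x + 2..z - 1}" by (auto simp: R_def F_def)
      then show "(swap_next x u, swap_next x v) \<in> R"
      proof cases
        case 1
        \<comment> \<open>From \<open>h \<noteq> x\<close>, the bounds \<open>x \<le> h\<close> and
          \<open>x + 1 \<le> h\<close> are equivalent; likewise \<open>u < x\<close> and
          \<open>u < x + 1\<close>, as \<open>u \<noteq> x\<close>. So exchanging \<open>x\<close>
          and \<open>x + 1\<close> in \<open>v\<close> is harmless.\<close>
        have u: "u \<noteq> x" "u \<noteq> x + 1" "h \<noteq> x" using K[OF 1(2,3)] by auto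
        then have "u < swap_next x v" "swap_next x v \<le> h" "swap_next x u = u"
          using 1 by (auto simp: Transposition.transpose_def)
        then show ?thesis using 1 unfolding R_def F_def by auto
      next
        case 2
        then have "swap_next x u \<in> {x, x + 1}" "swap_next x v = v"
          by (auto simp: Transposition.transpose_def)
        then show ?thesis using 2 unfolding R_def by auto
      qed
    qed
  qed (use assms(3) xz finite_vertices in auto)
  show "LLTe P (qvar + 1) M = (qvar + 1) * LLTe Q (qvar + 1) M"
    unfolding LLTe_eq_sum[OF disjoint_nonstrict_strict[OF assms(1)]]
      LLTe_eq_sum[OF disjoint_nonstrict_strict[OF Q]] NP NQ SP SQ ver add_diff_cancel_right'
    by (rule sum_Pow_relation)
qed

end
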